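(* Let $\mathbb{S}\subset\mathbb{P}_m(\mathbb{C}^{n\times n})$ be either the set of $H$-even or the set of $H$-odd matrix polynomials, let $P\in\mathbb{S}$ be regular, and let $\epsilon>0$ (with $\infty$ not in the relevant $\epsilon$-pseudospectra of $P$). Then for $M\in\{2,F\}$ and every $\lambda\in i\mathbb{R}$, $\eta_M^{\mathbb{S}}(\lambda,P)=\eta(\lambda,P)$, and $\sigma_\epsilon^{\mathbb{S}}(P)\cap i\mathbb{R}=\sigma_\epsilon(P)\cap i\mathbb{R}$.
   Context: $m,n\ge1$ are integers. $\mathbb{P}_m(\mathbb{C}^{n\times n})$ is the vector space of matrix polynomials $P(z)=\sum_{j=0}^m z^jA_j$, $A_j\in\mathbb{C}^{n\times n}$. $P$ is regular if $\det P(z)\not\equiv0$; $H$-even if $A_j$ is Hermitian for even $j$ (including $0$) and skew-Hermitian for odd $j$; $H$-odd if $A_j$ is skew-Hermitian for even $j$ and Hermitian for odd $j$. $i\mathbb{R}$ is the imaginary axis. $\sigma(P):=\{z\in\mathbb{C}:\det P(z)=0\}$. For $M\in\{2,F\}$, $|||P|||_M:=\left(\sum_{j=0}^m\|A_j\|_M^2\right)^{1/2}$ with $\|\cdot\|_F$ Frobenius and $\|\cdot\|_2$ spectral norm. For $x\in\mathbb{C}^n$ with $\|x\|_2=1$: $\eta(\lambda,x,P):=\inf\{|||\Delta P|||_M:\Delta P\in\mathbb{P}_m(\mathbb{C}^{n\times n}),\ P(\lambda)x+\Delta P(\lambda)x=0\}=\|P(\lambda)x\|_2/\|[1,\lambda,\ldots,\lambda^m]^T\|_2$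 (same for $M=2,F$) and $\eta_M^{\mathbb{S}}(\lambda,x,P):=\inf\{|||\Delta P|||_M:\Delta P\in\mathbb{S},\ P(\lambda)x+\Delta P(\lambda)x=0\}$. Backward errors of $\lambda$: $\eta(\lambda,P):=\min_{\|x\|_2=1}\eta(\lambda,x,P)$, $\eta_M^{\mathbb{S}}(\lambda,P):=\min_{\|x\|_2=1}\eta_M^{\mathbb{S}}(\lambda,x,P)$. Pseudospectra: $\sigma_\epsilon(P):=\bigcup\{\sigma(P+\Delta P):\Delta P\in\mathbb{P}_m(\mathbb{C}^{n\times n}),\ |||\Delta P|||_M\le\epsilon\}$ (the same set for $M=2,F$) and $\sigma_\epsilon^{\mathbb{S}}(P):=\bigcup\{\sigma(P+\Delta P):\Delta P\in\mathbb{S},\ |||\Delta P|||_M\le\epsilon\}$. Only finite eigenvalues are considered; the paper assumes throughout, for simplicity, that $\infty\notin\sigma_\epsilon(P)$. *)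

theory Defs
  imports "HOL-Analysis.Analysis" "HOL-Computational_Algebra.Polynomial"
begin

text \<open>
  A matrix polynomial is a polynomial whose coefficients are \<open>n \<times> n\<close> complex matrices,
  where \<open>n = CARD('n)\<close>. Only the additive structure of the type \<open>poly\<close> is used; evaluation
  is defined here because matrices do not form a commutative semiring.
\<close>

type_synonym 'n cmat = "complex^'n^'n"

definition mat_polys :: "nat \<Rightarrow> ('n::finite) cmat poly set" where
  "mat_polys m = {P. degree P \<le> m}"

definition eval_mp :: "('n::finite) cmat poly \<Rightarrow> complex \<Rightarrow> 'n cmat" where
  "eval_mp P z = (\<chi> i k. \<Sum>j\<le>degree P. z ^ j * coeff P j $ i $ k)"

definition regular_mp :: "('n::finite) cmat poly \<Rightarrow> bool" where
  "regular_mp P \<longleftrightarrow> (\<exists>z. det (eval_mp P z) \<noteq> 0)"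

definition conj_transpose :: "('n::finite) cmat \<Rightarrow> 'n cmat" where
  "conj_transpose A = (\<chi> i k. cnj (A $ k $ i))"

definition hermitian :: "('n::finite) cmat \<Rightarrow> bool" where
  "hermitian A \<longleftrightarrow> conj_transpose A = A"

definition skew_hermitian :: "('n::finite) cmat \<Rightarrow> bool" where
  "skew_hermitian A \<longleftrightarrow> conj_transpose A = - A"

definition H_even :: "nat \<Rightarrow> ('n::finite) cmat poly set" where
  "H_even m = {P \<in> mat_polys m. \<forall>j\<le>m.
     (even j \<longrightarrow> hermitian (coeff P j)) \<and> (odd j \<longrightarrow> skew_hermitian (coeff P j))}"

definition H_odd :: "nat \<Rightarrow> ('n::finite) cmat poly set" where
  "H_odd m = {P \<in> mat_polys m. \<forall>j\<le>m.
     (even j \<longrightarrow> skew_hermitian (coeff P j)) \<and> (odd j \<longrightarrow> hermitian (coeff P j))}"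

datatype norm_kind = Spectral | Frobenius

text \<open>The library norm on \<^typ>\<open>complex^'n\<close> is the Euclidean norm, so the operator norm below
  is the spectral norm.\<close>

fun mat_norm :: "norm_kind \<Rightarrow> ('n::finite) cmat \<Rightarrow> real" where
  "mat_norm Spectral A = onorm (\<lambda>x. A *v x)"
| "mat_norm Frobenius A = sqrt (\<Sum>i\<in>UNIV. \<Sum>k\<in>UNIV. (cmod (A $ i $ k))\<^sup>2)"

definition mp_norm :: "norm_kind \<Rightarrow> nat \<Rightarrow> ('n::finite) cmat poly \<Rightarrow> real" where
  "mp_norm M m P = sqrt (\<Sum>j=0..m. (mat_norm M (coeff P j))\<^sup>2)"

text \<open>
  Backward errors with perturbations restricted to a set \<open>S\<close> of matrix polynomials; the
  unstructured ones are the instances \<open>S = mat_polys m\<close>. When \<open>P\<close> lies in \<open>S\<close> and \<open>S\<close> is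
  closed under negation, \<open>- P\<close> is an admissible perturbation, so the infimum is over a
  nonempty set of nonnegative reals.
\<close>

definition eigenpair_backward_error ::
  "norm_kind \<Rightarrow> nat \<Rightarrow> ('n::finite) cmat poly set \<Rightarrow> complex \<Rightarrow> complex^'n \<Rightarrow> 'n cmat poly \<Rightarrow> real"
  where
  "eigenpair_backward_error M m S z x P =
     Inf {mp_norm M m D | D. D \<in> S \<and> eval_mp P z *v x + eval_mp D z *v x = 0}"

text \<open>\<open>Min\<close> is restricted to finite sets; \<open>LEAST\<close> denotes an attained minimum.\<close>

definition struct_backward_error ::
  "norm_kind \<Rightarrow> nat \<Rightarrow> ('n::finite) cmat poly set \<Rightarrow> complex \<Rightarrow> 'n cmat poly \<Rightarrow> real" where
  "struct_backward_error M m S z P =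
     (LEAST r. \<exists>x. norm x = 1 \<and> r = eigenpair_backward_error M m S z x P)"

definition backward_error ::
  "norm_kind \<Rightarrow> nat \<Rightarrow> complex \<Rightarrow> ('n::finite) cmat poly \<Rightarrow> real" where
  "backward_error M m z P = struct_backward_error M m (mat_polys m) z P"

definition mp_spectrum :: "('n::finite) cmat poly \<Rightarrow> complex set" where
  "mp_spectrum P = {z. det (eval_mp P z) = 0}"

definition struct_pseudospectrum ::
  "norm_kind \<Rightarrow> nat \<Rightarrow> ('n::finite) cmat poly set \<Rightarrow> real \<Rightarrow> 'n cmat poly \<Rightarrow> complex set" where
  "struct_pseudospectrum M m S \<epsilon> P =
     \<Union> {mp_spectrum (P + D) | D. D \<in> S \<and> mp_norm M m D \<le> \<epsilon>}"

definition pseudospectrum ::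
  "norm_kind \<Rightarrow> nat \<Rightarrow> real \<Rightarrow> ('n::finite) cmat poly \<Rightarrow> complex set" where
  "pseudospectrum M m \<epsilon> P = struct_pseudospectrum M m (mat_polys m) \<epsilon> P"

text \<open>
  For an element of \<open>mat_polys m\<close>, infinity is an eigenvalue iff \<open>0\<close> is an eigenvalue of the
  reversal \<open>z\<^sup>m P(1/z)\<close>, whose value at \<open>0\<close> is the coefficient of \<open>z\<^sup>m\<close>.
\<close>

definition infinite_eigenvalue :: "nat \<Rightarrow> ('n::finite) cmat poly \<Rightarrow> bool" where
  "infinite_eigenvalue m P \<longleftrightarrow> det (coeff P m) = 0"

definition infinity_in_pseudospectrum ::
  "norm_kind \<Rightarrow> nat \<Rightarrow> real \<Rightarrow> ('n::finite) cmat poly \<Rightarrow> bool" where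
  "infinity_in_pseudospectrum M m \<epsilon> P \<longleftrightarrow>
     (\<exists>D \<in> mat_polys m. mp_norm M m D \<le> \<epsilon> \<and> infinite_eigenvalue m (P + D))"

definition imag_axis :: "complex set" where
  "imag_axis = {\<i> * complex_of_real t | t. True}"

end

theory Submission imports Defs
begin

text \<open>
  For \<open>z\<close> on the imaginary axis and \<open>P\<close> in \<open>H_even m\<close> or \<open>H_odd m\<close>, the matrix \<open>P(z)\<close> is
  Hermitian or skew-Hermitian, so its smallest singular value is \<open>\<bar>\<mu>\<bar>\<close> for some eigenvalue
  \<open>\<mu>\<close> with a unit eigenvector \<open>x\<close>. With \<open>L = \<parallel>(1, z, \<dots>, z\<^sup>m)\<parallel>\<close>, Cauchy-Schwarz shows that
  every perturbation making \<open>z\<close> an eigenvalue has norm at least \<open>\<bar>\<mu>\<bar> / L\<close>. The perturbation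
  with coefficients \<open>- \<mu> cnj(z\<^sup>j) L\<^sup>-\<^sup>2 x x\<^sup>*\<close> attains this bound in both norms, and it has the
  symmetry of \<open>P\<close>, because \<open>z\<^sup>j\<close> is alternately real and imaginary while \<open>\<mu>\<close> is real in the
  Hermitian and imaginary in the skew-Hermitian case.
\<close>

subsection \<open>Matrix norms\<close>

lemma norm_vector_scalar_mult:
  fixes x :: "'a::real_normed_div_algebra^'n"
  shows "norm (c *s x) = norm c * norm x"
  by (simp add: norm_vec_def norm_mult L2_set_right_distrib)

text \<open>The norm of a nested vector is the Frobenius norm: Cauchy-Schwarz is applied row by row,
  and \<open>L2_set\<close> collects the rows.\<close>

lemma norm_matrix_vector_mult_le:
  fixes A :: "'a::real_normed_field^'n^'m"
  shows "norm (A *v x) \<le> norm A * norm x"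
proof -
  have row: "norm ((A *v x) $ i) \<le> norm (A $ i) * norm x" for i
  proof -
    have "norm ((A *v x) $ i) \<le> (\<Sum>k\<in>UNIV. \<bar>norm (A $ i $ k)\<bar> * \<bar>norm (x $ k)\<bar>)"
      unfolding matrix_vector_mult_def
      by (simp, rule order_trans[OF norm_sum]) (simp add: norm_mult)
    also have "\<dots> \<le> norm (A $ i) * norm x"
      unfolding norm_vec_def[of "A $ i"] norm_vec_def[of x] by (rule L2_set_mult_ineq)
    finally show ?thesis .
  qed
  have "norm (A *v x) \<le> L2_set (\<lambda>i. norm (A $ i) * norm x) UNIV"
    unfolding norm_vec_def[of "A *v x"] by (intro L2_set_mono row) simp
  also have "\<dots> = norm A * norm x"
    unfolding norm_vec_def[of A] by (simp add: L2_set_left_distrib)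
  finally show ?thesis .
qed

lemma mat_norm_Frobenius_eq: "mat_norm Frobenius A = norm A"
  by (simp add: norm_vec_def L2_set_def sum_nonneg)

lemma mat_norm_nonneg: "0 \<le> mat_norm M (A :: ('n::finite) cmat)"
  by (cases M) (simp_all add: sum_nonneg onorm_pos_le)

text \<open>Serves the lower bound on perturbations for both norms at once;
  \<open>mat_norm_le_norm\<close> serves the upper bound.\<close>

lemma norm_matrix_vector_mult_le_mat_norm:
  "norm (A *v x) \<le> mat_norm M A * norm (x :: complex^'n::finite)"
proof (cases M)
  case Spectral
  then show ?thesis by (simp add: onorm)
next
  case Frobenius
  then show ?thesis
    using norm_matrix_vector_mult_le[of A x] by (simp only: mat_norm_Frobenius_eq)
qed

lemma mat_norm_le_norm: "mat_norm M A \<le> norm (A :: ('n::finite) cmat)"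
proof (cases M)
  case Spectral
  then show ?thesis by (simp add: onorm_le norm_matrix_vector_mult_le)
next
  case Frobenius
  then show ?thesis by (simp only: mat_norm_Frobenius_eq)
qed

text \<open>This is c x x^*. Conjugate transposition only conjugates \<open>c\<close>, so the scalar
  alone decides the symmetry.\<close>

definition rank_one :: "complex \<Rightarrow> complex^'n \<Rightarrow> ('n::finite) cmat" where
  "rank_one c x = (\<chi> i k. c * x $ i * cnj (x $ k))"

lemma norm_rank_one: "norm (rank_one c x) = cmod c * (norm x)\<^sup>2"
proof -
  have "norm (rank_one c x $ i) = norm c * norm (x $ i) * norm x" for i
    unfolding norm_vec_def[of "rank_one c x $ i"] norm_vec_def[of x]
    by (simp add: rank_one_def norm_mult L2_set_right_distrib)
  then show ?thesis
    unfolding norm_vec_def[of "rank_one c x"]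
    by (simp add: norm_vec_def[of x] power2_eq_square flip: L2_set_right_distrib L2_set_left_distrib)
qed

lemma rank_one_mult_self: "rank_one c x *v x = (c * of_real ((norm x)\<^sup>2)) *s x"
proof -
  have "(\<Sum>k\<in>UNIV. cnj (x $ k) * x $ k) = of_real ((norm x)\<^sup>2)"
    by (simp add: norm_vec_def L2_set_def sum_nonneg complex_norm_square mult.commute
        del: of_real_power)
  then show ?thesis
    by (simp add: vec_eq_iff rank_one_def matrix_vector_mult_def mult.assoc
        flip: sum_distrib_left)
qed

text \<open>A singular matrix has no left inverse, hence a nonzero kernel vector, which is rescaled.
  This passes from determinants to the unit vectors of the backward error.\<close>

lemma det_eq_0_iff_unit_kernel:
  fixes A :: "('n::finite) cmat"
  shows "det A = 0 \<longleftrightarrow> (\<exists>x. norm x = 1 \<and> A *v x = 0)"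
proof -
  have "det A = 0 \<longleftrightarrow> (\<exists>x. x \<noteq> 0 \<and> A *v x = 0)"
    using invertible_det_nz[of A] invertible_left_inverse[of A] matrix_left_invertible_ker[of A]
    by blast
  also have "\<dots> \<longleftrightarrow> (\<exists>x. norm x = 1 \<and> A *v x = 0)"
  proof (safe)
    fix x assume x: "x \<noteq> 0" "A *v x = 0"
    have "norm (of_real (inverse (norm x)) *s x) = 1"
      using x by (simp add: norm_vector_scalar_mult norm_inverse)
    moreover have "A *v (of_real (inverse (norm x)) *s x) = 0"
      using x by (simp only: vector_scalar_commute) simp
    ultimately show "\<exists>x. norm x = 1 \<and> A *v x = 0" by blast
  next
    fix x :: "complex^'n" assume "norm x = 1" "A *v x = 0"
    then show "\<exists>x. x \<noteq> 0 \<and> A *v x = 0" by (intro exI[of _ x]) auto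
  qed
  finally show ?thesis .
qed

subsection \<open>An eigenvector realising the smallest singular value\<close>

text \<open>The inner product on \<^typ>\<open>complex^'n\<close> is the real part of the Hermitian one.\<close>

lemma inner_matrix_vector_mult_symmetric:
  fixes E :: "('n::finite) cmat" and s :: real
  assumes E: "\<And>i k. cnj (E $ k $ i) = of_real s * E $ i $ k" and ss: "s * s = 1"
  shows "(E *v x) \<bullet> y = s * (x \<bullet> (E *v y))"
proof -
  have inner: "u \<bullet> v = Re (\<Sum>i\<in>UNIV. u $ i * cnj (v $ i))" for u v :: "complex^'n"
    by (simp add: inner_vec_def inner_complex_def)
  have "s * (x \<bullet> (E *v y))
      = Re (\<Sum>k\<in>UNIV. \<Sum>i\<in>UNIV. of_real s * (x $ k * (cnj (E $ k $ i) * cnj (y $ i))))"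
    unfolding inner Re_complex_of_real[symmetric] matrix_vector_mult_def
    by (simp add: sum_distrib_left)
  \<comment> \<open>By \<open>E\<close> each conjugated entry contributes a second factor
    \<open>s\<close>, and the two multiply to 1.\<close>
  also have "\<dots> = Re (\<Sum>k\<in>UNIV. \<Sum>i\<in>UNIV. of_real (s * s) * (E $ i $ k * x $ k * cnj (y $ i)))"
    unfolding E by (simp add: mult_ac)
  also have "\<dots> = Re (\<Sum>i\<in>UNIV. \<Sum>k\<in>UNIV. E $ i $ k * x $ k * cnj (y $ i))"
    using ss by (subst sum.swap) simp
  also have "\<dots> = (E *v x) \<bullet> y"
    unfolding inner matrix_vector_mult_def by (simp add: sum_distrib_right)
  finally show ?thesis by simp
qed

text \<open>The quadratic form is minimal at \<open>x\<close>, so its derivative in direction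
  \<open>K x\<close>, twice the squared norm of \<open>K x\<close>, must vanish.\<close>

lemma kernel_of_positive_semidefinite:
  fixes K :: "'a::real_inner \<Rightarrow> 'a"
  assumes K: "linear K" and sym: "\<And>x y. K x \<bullet> y = x \<bullet> K y"
    and psd: "\<And>x. 0 \<le> K x \<bullet> x" and x: "K x \<bullet> x = 0"
  shows "K x = 0"
proof -
  define a where "a = K x \<bullet> K x"
  \<comment> \<open>The summand 1 keeps \<open>d\<close> positive; the step \<open>t\<close> then
    makes the form negative unless \<open>a = 0\<close>.\<close>
  define d where "d = K (K x) \<bullet> K x + 1"
  define t where "t = - a / d"
  have d: "d \<ge> 1" using psd[of "K x"] by (simp add: d_def)
  have "0 \<le> K (x + t *\<^sub>R K x) \<bullet> (x + t *\<^sub>R K x)" by (rule psd)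
  also have "\<dots> = 2 * t * a + t\<^sup>2 * (d - 1)"
    using x by (simp add: linear_add[OF K] linear_cmul[OF K] inner_add_left inner_add_right
        a_def d_def sym power2_eq_square algebra_simps)
  also have "\<dots> = - (a\<^sup>2 * (d + 1) / d\<^sup>2)"
    using d by (simp add: t_def power2_eq_square field_simps)
  finally have "a\<^sup>2 * (d + 1) / d\<^sup>2 \<le> 0" by simp
  moreover have "a\<^sup>2 * (d + 1) / d\<^sup>2 > 0" if "a \<noteq> 0"
    using d that by (intro divide_pos_pos mult_pos_pos) auto
  ultimately have "a = 0" by fastforce
  then show ?thesis by (simp add: a_def)
qed

text \<open>Compactness gives a minimiser \<open>x0\<close> of the norm of E x on the unit sphere,
  with value \<open>r\<close>. Since E^* = s E, the map \<open>K\<close> is E^* E - r^2, positive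
  semidefinite with zero quadratic form at \<open>x0\<close>; hence E^2 x0 = s r^2 x0. With w^2 = s
  r^2, the factorisation (E - w)(E + w) yields an eigenvector for w or -w.\<close>

lemma ex_minimal_eigenvector:
  fixes E :: "('n::finite) cmat" and s :: real
  assumes E: "\<And>i k. cnj (E $ k $ i) = of_real s * E $ i $ k" and s: "s = 1 \<or> s = -1"
  obtains x \<mu> where "norm x = 1" "E *v x = \<mu> *s x" "cnj \<mu> = of_real s * \<mu>"
    "\<And>y. cmod \<mu> * norm y \<le> norm (E *v y)"
proof -
  have ss: "s * s = 1" using s by auto
  have adj: "(E *v x) \<bullet> y = s * (x \<bullet> (E *v y))" for x y
    by (rule inner_matrix_vector_mult_symmetric[OF E ss])
  obtain x0 where x0: "norm x0 = 1" and min: "\<And>y. norm y = 1 \<Longrightarrow> norm (E *v x0) \<le> norm (E *v y)"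
  proof -
    have "\<exists>x\<in>sphere 0 1. \<forall>y\<in>sphere 0 1. norm (E *v x) \<le> norm (E *v y)"
    proof (rule continuous_attains_inf)
      show "(sphere 0 1 :: (complex^'n) set) \<noteq> {}" by simp
      show "continuous_on (sphere 0 1) (\<lambda>x. norm (E *v x))"
        by (intro continuous_intros linear_continuous_on) simp
    qed simp
    then show ?thesis by (auto intro: that)
  qed
  define r where "r = norm (E *v x0)"
  have lower: "r * norm y \<le> norm (E *v y)" for y
  proof (cases "y = 0")
    case False
    have "r \<le> norm (E *v (of_real (inverse (norm y)) *s y))"
      unfolding r_def using False by (intro min) (simp add: norm_vector_scalar_mult norm_inverse)
    also have "\<dots> = norm (E *v y) / norm y"
      unfolding vector_scalar_commute norm_vector_scalar_mult by (simp add: norm_inverse divide_inverse)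
    finally show ?thesis using False by (simp add: field_simps)
  qed simp
  define K where "K = (\<lambda>x. s *\<^sub>R (E *v (E *v x)) - r\<^sup>2 *\<^sub>R x)"
  have Kq: "K x \<bullet> x = (norm (E *v x))\<^sup>2 - (r * norm x)\<^sup>2" for x
    using adj[of "E *v x" x] ss
    by (simp add: K_def inner_diff_left power_mult_distrib dot_square_norm)
  have "K x0 = 0"
  proof (rule kernel_of_positive_semidefinite[of K])
    have lin: "linear ((*v) E)" by (simp add: bounded_linear.linear)
    show "linear K"
      by (rule linearI) (simp_all add: K_def linear_add[OF lin] linear_cmul[OF lin]
          scaleR_right_distrib scaleR_right_diff_distrib mult.commute)
    show "K x \<bullet> y = x \<bullet> K y" for x y
      using adj[of "E *v x" y] adj[of x "E *v y"] ss
      by (simp add: K_def inner_diff_left inner_diff_right)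
    show "0 \<le> K x \<bullet> x" for x
      using lower[of x] by (simp add: Kq power_mono r_def)
    show "K x0 \<bullet> x0 = 0" by (simp add: Kq x0 r_def)
  qed
  \<comment> \<open>A square root of s r^2, real or imaginary according to \<open>s\<close>, which
    gives the required conjugation rule.\<close>
  define w where "w = (if s = 1 then of_real r else \<i> * of_real r)"
  have w: "w * w = of_real (s * r\<^sup>2)" "cmod w = r" "cnj w = of_real s * w"
    using s by (auto simp: w_def norm_mult r_def power2_eq_square)
  have EE: "E *v (E *v x0) = (w * w) *s x0"
  proof -
    have "s *\<^sub>R (s *\<^sub>R (E *v (E *v x0))) = s *\<^sub>R (r\<^sup>2 *\<^sub>R x0)"
      using \<open>K x0 = 0\<close> by (simp add: K_def)
    then have "E *v (E *v x0) = (s * r\<^sup>2) *\<^sub>R x0" using ss by simp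
    then show ?thesis
      unfolding w(1) by (simp add: vec_eq_iff) (simp add: scaleR_conv_of_real)
  qed
  \<comment> \<open>E - w annihilates \<open>y\<close>, so a nonzero \<open>y\<close> is an
    eigenvector for \<open>w\<close>; if \<open>y = 0\<close>, then \<open>x0\<close> is one for
    \<open>- w\<close>.\<close>
  define y where "y = E *v x0 + w *s x0"
  show ?thesis
  proof (cases "y = 0")
    case True
    then have "E *v x0 = (- w) *s x0"
      by (simp add: y_def eq_neg_iff_add_eq_0)
    then show ?thesis using that[of x0 "- w"] x0 w lower by simp
  next
    case False
    let ?x = "of_real (inverse (norm y)) *s y"
    have "E *v y = w *s y"
      by (simp add: y_def matrix_vector_right_distrib vector_scalar_commute EE
          vector_add_ldistrib vector_smult_assoc add.commute)
    then have "E *v ?x = w *s ?x"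
      by (simp only: vector_scalar_commute vector_smult_assoc mult.commute)
    moreover have "norm ?x = 1" using False by (simp add: norm_vector_scalar_mult norm_inverse)
    ultimately show ?thesis using that[of ?x w] w lower by simp
  qed
qed

subsection \<open>Backward errors and pseudospectra\<close>

text \<open>Coefficients beyond the degree vanish. A common summation bound makes evaluation
  additive even when degrees differ or drop.\<close>

lemma eval_mp_eq:
  "eval_mp P z = (\<chi> i k. \<Sum>j\<le>m. z ^ j * coeff P j $ i $ k)" if "P \<in> mat_polys m"
proof -
  have "(\<Sum>j\<le>degree P. z ^ j * coeff P j $ i $ k) = (\<Sum>j\<le>m. z ^ j * coeff P j $ i $ k)" for i k
    using that by (intro sum.mono_neutral_left) (auto simp: mat_polys_def coeff_eq_0)
  then show ?thesis by (simp add: eval_mp_def)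
qed

lemma eval_mp_add:
  "eval_mp (P + D) z = eval_mp P z + eval_mp D z" if "P \<in> mat_polys m" "D \<in> mat_polys m"
proof -
  have "P + D \<in> mat_polys m" using that by (simp add: mat_polys_def degree_add_le)
  with that show ?thesis
    by (simp add: eval_mp_eq[of _ m] vec_eq_iff sum.distrib distrib_left)
qed

lemma eval_mp_uminus: "eval_mp (- P) z = - eval_mp P z"
  by (simp add: eval_mp_def vec_eq_iff sum_negf)

lemma eval_mp_mult_vector:
  "eval_mp P z *v x = (\<Sum>j\<le>m. z ^ j *s (coeff P j *v x))" if "P \<in> mat_polys m"
  unfolding eval_mp_eq[OF that] vec_eq_iff matrix_vector_mult_def
  by (auto simp: sum_distrib_right sum_distrib_left mult.assoc intro: sum.swap)

definition monomial_norm :: "nat \<Rightarrow> complex \<Rightarrow> real" where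
  "monomial_norm m z = L2_set (\<lambda>j. cmod (z ^ j)) {..m}"

lemma monomial_norm_pos: "0 < monomial_norm m z"
proof -
  \<comment> \<open>The entry with exponent 0 is 1, also at \<open>z = 0\<close>.\<close>
  have "cmod (z ^ 0) \<le> monomial_norm m z"
    unfolding monomial_norm_def by (rule member_le_L2_set) auto
  then show ?thesis by simp
qed

lemma mp_norm_eq: "mp_norm M m D = L2_set (\<lambda>j. mat_norm M (coeff D j)) {..m}"
  by (simp add: mp_norm_def L2_set_def atLeast0AtMost)

lemma mp_norm_nonneg: "0 \<le> mp_norm M m D"
  by (simp add: mp_norm_eq)

text \<open>Triangle inequality, then Cauchy-Schwarz pairing the powers of \<open>z\<close> with the
  coefficient norms.\<close>

lemma norm_eval_mp_le:
  assumes "D \<in> mat_polys m"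
  shows "norm (eval_mp D z *v x) \<le> monomial_norm m z * mp_norm M m D * norm x"
proof -
  have "norm (eval_mp D z *v x) \<le> (\<Sum>j\<le>m. cmod (z ^ j) * norm (coeff D j *v x))"
    unfolding eval_mp_mult_vector[OF assms]
    by (rule order_trans[OF norm_sum]) (simp add: norm_vector_scalar_mult)
  also have "\<dots> \<le> (\<Sum>j\<le>m. cmod (z ^ j) * (mat_norm M (coeff D j) * norm x))"
    by (intro sum_mono mult_left_mono norm_matrix_vector_mult_le_mat_norm) simp
  also have "\<dots> = (\<Sum>j\<le>m. \<bar>cmod (z ^ j)\<bar> * \<bar>mat_norm M (coeff D j)\<bar>) * norm x"
    by (simp add: mat_norm_nonneg sum_distrib_right mult.assoc)
  also have "\<dots> \<le> monomial_norm m z * mp_norm M m D * norm x"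
    unfolding monomial_norm_def mp_norm_eq by (intro mult_right_mono L2_set_mult_ineq) simp
  finally show ?thesis .
qed

text \<open>
  By the equality case of Cauchy-Schwarz, the coefficients of \<open>rank_one_poly m z c x\<close> are chosen
  proportional to \<open>cnj (z ^ j)\<close>.
\<close>

definition rank_one_poly :: "nat \<Rightarrow> complex \<Rightarrow> complex \<Rightarrow> complex^'n \<Rightarrow> ('n::finite) cmat poly" where
  "rank_one_poly m z c x =
     (\<Sum>j\<le>m. monom (rank_one (c * cnj (z ^ j) / of_real ((monomial_norm m z)\<^sup>2)) x) j)"

lemma coeff_rank_one_poly:
  "j \<le> m \<Longrightarrow> coeff (rank_one_poly m z c x) j =
     rank_one (c * cnj (z ^ j) / of_real ((monomial_norm m z)\<^sup>2)) x"
  by (simp add: rank_one_poly_def coeff_sum if_distrib sum.delta cong: if_cong)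

lemma rank_one_poly_in_mat_polys: "rank_one_poly m z c x \<in> mat_polys m"
  unfolding mat_polys_def rank_one_poly_def
  by (auto intro!: degree_sum_le order_trans[OF degree_monom_le])

text \<open>The products of z^j with its conjugate add up to the squared
  \<open>monomial_norm\<close>, which cancels the denominator.\<close>

lemma eval_rank_one_poly:
  assumes "norm x = 1"
  shows "eval_mp (rank_one_poly m z c x) z *v x = c *s x"
proof -
  let ?L = "monomial_norm m z"
  have L: "(\<Sum>j\<le>m. z ^ j * cnj (z ^ j)) = of_real (?L\<^sup>2)"
    by (simp add: monomial_norm_def L2_set_def sum_nonneg complex_norm_square
        del: of_real_power complex_cnj_power)
  have "eval_mp (rank_one_poly m z c x) z *v x
      = (\<Sum>j\<le>m. (z ^ j * (c * cnj (z ^ j) / of_real (?L\<^sup>2))) *s x)"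
    unfolding eval_mp_mult_vector[OF rank_one_poly_in_mat_polys]
    by (intro sum.cong refl)
      (simp add: coeff_rank_one_poly rank_one_mult_self assms vector_smult_assoc
        del: complex_cnj_power)
  also have "\<dots> = (\<Sum>j\<le>m. z ^ j * (c * cnj (z ^ j) / of_real (?L\<^sup>2))) *s x"
    by (simp add: vec_eq_iff sum_distrib_right)
  also have "(\<Sum>j\<le>m. z ^ j * (c * cnj (z ^ j) / of_real (?L\<^sup>2)))
      = (\<Sum>j\<le>m. z ^ j * cnj (z ^ j)) * (c / of_real (?L\<^sup>2))"
    unfolding sum_distrib_right by (intro sum.cong refl) simp
  also have "\<dots> = c"
    unfolding L using monomial_norm_pos[of m z] by simp
  finally show ?thesis .
qed

text \<open>Coefficient j has Frobenius norm |c| |z^j| / L^2 with L =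
  \<open>monomial_norm m z\<close>, and the |z^j| have Euclidean norm L. The Frobenius norm
  dominates both kinds, and an upper bound is enough to meet the general lower bound.\<close>

lemma mp_norm_rank_one_poly_le:
  assumes "norm x = 1"
  shows "mp_norm M m (rank_one_poly m z c x) \<le> cmod c / monomial_norm m z"
proof -
  let ?L = "monomial_norm m z"
  have "mp_norm M m (rank_one_poly m z c x) \<le> L2_set (\<lambda>j. cmod c / ?L\<^sup>2 * cmod (z ^ j)) {..m}"
    unfolding mp_norm_eq
  proof (intro L2_set_mono mat_norm_nonneg)
    fix j assume "j \<in> {..m}"
    then show "mat_norm M (coeff (rank_one_poly m z c x) j) \<le> cmod c / ?L\<^sup>2 * cmod (z ^ j)"
      using mat_norm_le_norm[of M "coeff (rank_one_poly m z c x) j"]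
      by (simp add: coeff_rank_one_poly norm_rank_one assms norm_mult norm_divide norm_power)
  qed
  also have "\<dots> = cmod c / ?L\<^sup>2 * ?L"
    unfolding monomial_norm_def by (subst L2_set_right_distrib) simp_all
  also have "\<dots> = cmod c / ?L"
    using monomial_norm_pos[of m z] by (simp add: power2_eq_square)
  finally show ?thesis .
qed

text \<open>\<open>S\<close> stands for the structured class as well as for all of
  \<open>mat_polys m\<close>. One witness lies in both, so both lead to the same value |\<mu>| / L,
  free of \<open>S\<close> and of the norm kind.\<close>

context
  fixes m :: nat and P :: "('n::finite) cmat poly" and S :: "'n cmat poly set"
    and z \<mu> :: complex and x :: "complex^'n"
  assumes P: "P \<in> mat_polys m" and S: "S \<subseteq> mat_polys m" "- P \<in> S"
    and x: "norm x = 1" "eval_mp P z *v x = \<mu> *s x"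
    and min: "\<And>y. cmod \<mu> * norm y \<le> norm (eval_mp P z *v y)"
    and witness: "rank_one_poly m z (- \<mu>) x \<in> S"
begin

text \<open>The chain is |\<mu>| \<le> |P(z) y| = |D(z) y| \<le> L times the norm of
  \<open>D\<close>.\<close>

lemma perturbation_norm_ge:
  assumes "D \<in> mat_polys m" "norm y = 1" "eval_mp P z *v y + eval_mp D z *v y = 0"
  shows "cmod \<mu> / monomial_norm m z \<le> mp_norm M m D"
proof -
  have "cmod \<mu> \<le> norm (eval_mp P z *v y)" using min[of y] assms by simp
  also have "\<dots> = norm (eval_mp D z *v y)"
    using assms(3) by (simp add: add_eq_0_iff2 add.commute)
  also have "\<dots> \<le> monomial_norm m z * mp_norm M m D"
    using norm_eval_mp_le[OF assms(1), of z y M] assms by simp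
  finally show ?thesis
    using monomial_norm_pos[of m z] by (simp add: field_simps)
qed

lemma witness_annihilates:
  "eval_mp P z *v x + eval_mp (rank_one_poly m z (- \<mu>) x) z *v x = 0"
  using x by (simp add: eval_rank_one_poly vec_eq_iff)

lemma eigenpair_backward_error_ge:
  assumes "norm y = 1"
  shows "cmod \<mu> / monomial_norm m z \<le> eigenpair_backward_error M m S z y P"
  unfolding eigenpair_backward_error_def
proof (rule cInf_greatest)
  \<comment> \<open>\<open>Inf\<close> needs a nonempty set: the perturbation \<open>- P\<close>
    annihilates every \<open>y\<close>.\<close>
  show "{mp_norm M m D |D. D \<in> S \<and> eval_mp P z *v y + eval_mp D z *v y = 0} \<noteq> {}"
    using S by (auto intro!: exI[of _ "- P"]
        simp: eval_mp_uminus simp flip: matrix_vector_mult_add_rdistrib)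
qed (use assms S perturbation_norm_ge in auto)

lemma struct_backward_error_eq:
  "struct_backward_error M m S z P = cmod \<mu> / monomial_norm m z"
  unfolding struct_backward_error_def
proof (rule Least_equality)
  \<comment> \<open>The witness bounds the error at \<open>x\<close> from above by the value that
    bounds it from below at every unit vector, so the minimum is attained at
    \<open>x\<close>.\<close>
  have "eigenpair_backward_error M m S z x P \<le> mp_norm M m (rank_one_poly m z (- \<mu>) x)"
    unfolding eigenpair_backward_error_def
    using witness witness_annihilates
    by (intro cInf_lower bdd_belowI[of _ 0]) (auto simp: mp_norm_nonneg)
  also have "\<dots> \<le> cmod \<mu> / monomial_norm m z"
    using mp_norm_rank_one_poly_le[OF x(1), of M m z "- \<mu>"] by simp
  finally show "\<exists>y. norm y = 1 \<and>
      cmod \<mu> / monomial_norm m z = eigenpair_backward_error M m S z y P"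
    using eigenpair_backward_error_ge[OF x(1), of M] x(1) by (intro exI[of _ x]) simp
qed (use eigenpair_backward_error_ge in auto)

text \<open>An actual perturbation attains the lower bound, so the criterion holds with a nonstrict
  inequality.\<close>

lemma struct_pseudospectrum_iff:
  "z \<in> struct_pseudospectrum M m S \<epsilon> P \<longleftrightarrow> cmod \<mu> / monomial_norm m z \<le> \<epsilon>"
proof
  assume "z \<in> struct_pseudospectrum M m S \<epsilon> P"
  then obtain D where D: "D \<in> S" "mp_norm M m D \<le> \<epsilon>" and "det (eval_mp (P + D) z) = 0"
    by (auto simp: struct_pseudospectrum_def mp_spectrum_def)
  then obtain y where "norm y = 1" "eval_mp P z *v y + eval_mp D z *v y = 0"
    using S P by (auto simp: det_eq_0_iff_unit_kernel eval_mp_add[of _ m] subset_iff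
        matrix_vector_mult_add_rdistrib)
  then show "cmod \<mu> / monomial_norm m z \<le> \<epsilon>"
    using D S perturbation_norm_ge[of D y M] by auto
next
  let ?D = "rank_one_poly m z (- \<mu>) x"
  assume "cmod \<mu> / monomial_norm m z \<le> \<epsilon>"
  then have "mp_norm M m ?D \<le> \<epsilon>"
    using mp_norm_rank_one_poly_le[OF x(1), of M m z "- \<mu>"] by simp
  moreover have "z \<in> mp_spectrum (P + ?D)"
    using x(1) witness_annihilates P rank_one_poly_in_mat_polys[of m z "- \<mu>" x]
    by (auto simp: mp_spectrum_def det_eq_0_iff_unit_kernel eval_mp_add[of _ m]
        matrix_vector_mult_add_rdistrib)
  ultimately show "z \<in> struct_pseudospectrum M m S \<epsilon> P"
    using witness by (auto simp: struct_pseudospectrum_def)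
qed

end

subsection \<open>Even and odd polynomials on the imaginary axis\<close>

text \<open>The common form of the two symmetries: \<open>s = 1\<close> is the even case, \<open>s = - 1\<close> the odd one.\<close>

definition H_sym :: "nat \<Rightarrow> real \<Rightarrow> ('n::finite) cmat poly set" where
  "H_sym m s = {P \<in> mat_polys m. \<forall>j\<le>m. \<forall>i k.
     cnj (coeff P j $ k $ i) = of_real s * (-1) ^ j * coeff P j $ i $ k}"

lemma H_even_eq_H_sym: "H_even m = H_sym m 1"
  unfolding H_even_def H_sym_def hermitian_def skew_hermitian_def conj_transpose_def
  by (intro Collect_cong conj_cong all_cong refl, rename_tac j, case_tac "even j")
    (simp_all add: vec_eq_iff)

lemma H_odd_eq_H_sym: "H_odd m = H_sym m (- 1)"
  unfolding H_odd_def H_sym_def hermitian_def skew_hermitian_def conj_transpose_def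
  by (intro Collect_cong conj_cong all_cong refl, rename_tac j, case_tac "even j")
    (simp_all add: vec_eq_iff)

lemma cnj_imag_axis: "z \<in> imag_axis \<Longrightarrow> cnj z = - z"
  by (auto simp: imag_axis_def)

lemma uminus_in_H_sym: "P \<in> H_sym m s \<Longrightarrow> - P \<in> H_sym m s"
  by (simp add: H_sym_def mat_polys_def)

text \<open>Conjugating z^j gives (- z)^j, whose sign cancels the alternating sign of the
  coefficients; only \<open>s\<close> remains.\<close>

lemma cnj_eval_mp_H_sym:
  assumes "P \<in> H_sym m s" "z \<in> imag_axis"
  shows "cnj (eval_mp P z $ k $ i) = of_real s * eval_mp P z $ i $ k"
proof -
  have P: "P \<in> mat_polys m" using assms by (simp add: H_sym_def)
  have "cnj (z ^ j * coeff P j $ k $ i) = of_real s * (z ^ j * coeff P j $ i $ k)" if "j \<le> m" for j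
  proof -
    have "(- z) ^ j * (of_real s * (- 1) ^ j * coeff P j $ i $ k)
        = ((- z) * (- 1)) ^ j * (of_real s * coeff P j $ i $ k)"
      by (simp only: power_mult_distrib mult_ac)
    then show ?thesis
      using assms that by (simp add: H_sym_def cnj_imag_axis)
  qed
  then show ?thesis
    by (simp add: eval_mp_eq[OF P] sum_distrib_left del: complex_cnj_mult)
qed

lemma rank_one_poly_in_H_sym:
  assumes "z \<in> imag_axis" "cnj c = of_real s * c"
  shows "rank_one_poly m z c x \<in> H_sym m s"
proof -
  have "z ^ j = (- 1) ^ j * (- z) ^ j" for j
    by (simp flip: power_mult_distrib)
  \<comment> \<open>Conjugation of this factor produces the alternating sign of
    \<open>H_sym\<close>, while conjugation of \<open>c\<close> produces \<open>s\<close>.\<close>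
  then have "cnj (cnj (z ^ j)) = (- 1) ^ j * cnj (z ^ j)" for j
    using assms(1) by (simp add: cnj_imag_axis)
  then show ?thesis
    using assms(2) rank_one_poly_in_mat_polys[of m z c x]
    by (simp add: H_sym_def coeff_rank_one_poly rank_one_def mult_ac del: complex_cnj_power
        flip: of_real_power)
qed

theorem theorem5p4:
  fixes m :: nat and S :: "('n::finite) cmat poly set" and P :: "'n cmat poly"
    and \<epsilon> :: real and M N :: norm_kind
  assumes "m \<ge> 1"
    and "S = H_even m \<or> S = H_odd m"
    and "P \<in> S"
    and "regular_mp P"
    and "\<epsilon> > 0"
    and "\<not> infinity_in_pseudospectrum N m \<epsilon> P"
  shows "(\<forall>z\<in>imag_axis. struct_backward_error M m S z P = backward_error N m z P) \<and>
    struct_pseudospectrum M m S \<epsilon> P \<inter> imag_axis = pseudospectrum N m \<epsilon> P \<inter> imag_axis"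
proof -
  obtain s where s: "s = 1 \<or> s = - 1" and S: "S = H_sym m s"
    using assms(2) H_even_eq_H_sym H_odd_eq_H_sym by metis
  have P: "P \<in> H_sym m s" "P \<in> mat_polys m" using assms(3) by (simp_all add: S H_sym_def)
  have "struct_backward_error M m S z P = backward_error N m z P \<and>
      (z \<in> struct_pseudospectrum M m S \<epsilon> P \<longleftrightarrow> z \<in> pseudospectrum N m \<epsilon> P)"
    if z: "z \<in> imag_axis" for z
  proof -
    obtain x \<mu> where x: "norm x = 1" "eval_mp P z *v x = \<mu> *s x"
      and \<mu>: "cnj \<mu> = of_real s * \<mu>"
      and min: "\<And>y. cmod \<mu> * norm y \<le> norm (eval_mp P z *v y)"
      using ex_minimal_eigenvector[OF cnj_eval_mp_H_sym[OF P(1) z] s] by blast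
    have in_S: "rank_one_poly m z (- \<mu>) x \<in> S"
      unfolding S by (intro rank_one_poly_in_H_sym z) (simp add: \<mu>)
    have SM: "S \<subseteq> mat_polys m" "- P \<in> S"
      using uminus_in_H_sym[OF P(1)] by (auto simp: S) (auto simp: H_sym_def)
    have U: "mat_polys m \<subseteq> mat_polys m" "- P \<in> mat_polys m"
      using SM by auto
    \<comment> \<open>The same \<open>x\<close> and \<open>\<mu>\<close> enter both instances, so
      the two backward errors and the two membership criteria coincide even for different norm kinds
      \<open>M\<close> and \<open>N\<close>.\<close>
    note structured = P(2) SM x min in_S
    note unstructured = P(2) U x min rank_one_poly_in_mat_polys
    show ?thesis
      unfolding backward_error_def pseudospectrum_def
      by (simp add: struct_backward_error_eq[OF structured] struct_backward_error_eq[OF unstructured]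
          struct_pseudospectrum_iff[OF structured] struct_pseudospectrum_iff[OF unstructured])
  qed
  then show ?thesis by blast
qed

end
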